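(* Let $a>1$. Then: 1. for every $n\in\mathbb{N}$, $S_{n,a}^*$ is a linear and positive operator on $C_B[0,\infty)$; 2. $S_{n,a}^*(a^t;x)=a^x$ for all $x\in[0,\infty)$ and all $n\in\mathbb{N}$ (i.e. $S_{n,a}^*$ applied to the function $t\mapsto a^t$ and evaluated at $x$); 3. if $f\in C_\rho[0,\infty)$ with $\rho\ge 2$, then for every $b>0$, $\lim_{n\to\infty}S_{n,a}^*(f;x)= f(x)$ uniformly for $x\in[0,b]$.
   Context: For $a>1$, $n\in\mathbb{N}=\{1,2,\dots\}$ and $x\ge 0$, the operator $S_{n,a}^*$ is defined by $$S_{n,a}^*(f;x)=\sum_{k=0}^{\infty}a^{\left(\frac{-x}{-1+a^{1/n}}\right)}\frac{(x\log a)^k}{(-1+a^{1/n})^k\,k!}\,f\!\left(\frac{k}{n}\right),$$ for functions $f:[0,\infty)\to\mathbb{R}$ for which the series converges ($\log$ is the natural logarithm, and $0^0=1$). $C_B[0,\infty)$ is the space of all continuous bounded real functions on $[0,\infty)$. For $\rho>0$, $C_\rho[0,\infty)$ is the space of $f\in C[0,\infty)$ for which $\lim_{x\to\infty}\frac{f(x)}{1+x^\rho}$ exists and is finite. Positive means $f\ge 0$ implies $S_{n,a}^*(f;\cdot)\ge 0$. *)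

theory Defs
  imports "HOL-Analysis.Analysis"
begin

text \<open>
  A function \<open>[0,\<infinity>) \<rightarrow> \<real>\<close> is represented by a total function \<open>real \<Rightarrow> real\<close> of which only the
  values on \<open>{0..}\<close> matter: all notions below refer to arguments in \<open>{0..}\<close> only, and equality
  of functions is equality on \<open>{0..}\<close>.
\<close>

definition S_star_term :: "nat \<Rightarrow> real \<Rightarrow> (real \<Rightarrow> real) \<Rightarrow> real \<Rightarrow> nat \<Rightarrow> real" where
  "S_star_term n a f x k =
     a powr (- x / (- 1 + a powr (1 / real n)))
       * ((x * ln a) ^ k / ((- 1 + a powr (1 / real n)) ^ k * fact k))
       * f (real k / real n)"

text \<open>
  \<open>S_star n a f\<close> is meaningful only if the series converges at every \<open>x \<ge> 0\<close>, since \<open>suminf\<close> is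
  unspecified on divergent series; this is what \<open>S_star_defined\<close> records.
\<close>

definition S_star_defined :: "nat \<Rightarrow> real \<Rightarrow> (real \<Rightarrow> real) \<Rightarrow> bool" where
  "S_star_defined n a f \<longleftrightarrow> (\<forall>x\<ge>0. summable (S_star_term n a f x))"

definition S_star :: "nat \<Rightarrow> real \<Rightarrow> (real \<Rightarrow> real) \<Rightarrow> real \<Rightarrow> real" where
  "S_star n a f x = (\<Sum>k. S_star_term n a f x k)"

definition C_B :: "(real \<Rightarrow> real) set" where
  "C_B = {f. continuous_on {0..} f \<and> bounded (f ` {0..})}"

definition C_rho :: "real \<Rightarrow> (real \<Rightarrow> real) set" where
  "C_rho \<rho> = {f. continuous_on {0..} f \<and>
                 (\<exists>L. ((\<lambda>x. f x / (1 + x powr \<rho>)) \<longlongrightarrow> L) at_top)}"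

text \<open>An operator on \<open>V\<close> maps \<open>V\<close> into itself.\<close>

definition linear_operator_on ::
    "(real \<Rightarrow> real) set \<Rightarrow> ((real \<Rightarrow> real) \<Rightarrow> real \<Rightarrow> real) \<Rightarrow> bool" where
  "linear_operator_on V T \<longleftrightarrow>
     (\<forall>f\<in>V. T f \<in> V) \<and>
     (\<forall>f\<in>V. \<forall>g\<in>V. \<forall>x\<ge>0. T (\<lambda>t. f t + g t) x = T f x + T g x) \<and>
     (\<forall>c. \<forall>f\<in>V. \<forall>x\<ge>0. T (\<lambda>t. c * f t) x = c * T f x)"

definition positive_operator_on ::
    "(real \<Rightarrow> real) set \<Rightarrow> ((real \<Rightarrow> real) \<Rightarrow> real \<Rightarrow> real) \<Rightarrow> bool" where
  "positive_operator_on V T \<longleftrightarrow>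
     (\<forall>f\<in>V. (\<forall>t\<ge>0. f t \<ge> 0) \<longrightarrow> (\<forall>x\<ge>0. T f x \<ge> 0))"

end

theory Submission
  imports Defs "HOL-Real_Asymp.Real_Asymp"
begin

text \<open>
  Put \<open>h = a\<^sup>1\<^sup>/\<^sup>n - 1\<close> and \<open>\<lambda> = ln a / h\<close>. Then \<open>S_star n a f x\<close> is the mean of \<open>f (N / n)\<close> for a
  Poisson variable \<open>N\<close> of parameter \<open>\<lambda> x\<close>, and the exponential series gives the exact value
  \<open>exp (\<lambda> x (a\<^sup>m\<^sup>/\<^sup>n - 1))\<close> at the function \<open>t \<mapsto> a\<^sup>m\<^sup>t\<close>. For \<open>m = 0\<close> this is \<open>1\<close>, for \<open>m = 1\<close> it is \<open>a\<^sup>x\<close>,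
  and for \<open>m = 2\<close> it is \<open>a\<^sup>2\<^sup>x a\<^sup>x\<^sup>h\<close>, because \<open>a\<^sup>2\<^sup>/\<^sup>n - 1 = h (2 + h)\<close>
  (lemmas \<open>S_star_term_exponential_sums\<close> and \<open>S_star_term_powr2_sums\<close>).

  Convergence follows by a Korovkin argument with the squared distance measured on the scale
  \<open>t \<mapsto> a\<^sup>t\<close>. The three exact values give
  \<open>S\<^sub>n ((a\<^sup>t - a\<^sup>x)\<^sup>2; x) = a\<^sup>2\<^sup>x (a\<^sup>x\<^sup>h - 1)\<close>, which tends to \<open>0\<close> uniformly on compact sets as
  \<open>h \<rightarrow> 0\<close> (lemma \<open>squared_deviation_sums\<close>). On the other hand
  every continuous \<open>f\<close> with \<open>f t = O(a\<^sup>2\<^sup>t)\<close> satisfies \<open>\<bar>f t - f x\<bar> \<le> \<epsilon> + C (a\<^sup>t - a\<^sup>x)\<^sup>2\<close> for all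
  \<open>t \<ge> 0\<close> and \<open>x \<in> [0, b]\<close> (lemma \<open>modulus_by_squared_deviation\<close>); applying the
  positive operator to this inequality bounds \<open>\<bar>S\<^sub>n (f; x) - f x\<bar>\<close>. The functions of polynomial growth and
  the bounded functions are all \<open>O(a\<^sup>2\<^sup>t)\<close>, and the same growth bound makes their series converge.
\<close>

section \<open>The Poisson weights\<close>

definition poisson_rate :: "nat \<Rightarrow> real \<Rightarrow> real" where
  "poisson_rate n a = ln a / (a powr (1 / real n) - 1)"

lemma powr_inverse_gt_one:
  fixes a :: real
  assumes "a > 1" "n \<ge> 1"
  shows "a powr (1 / real n) > 1"
  using assms by (simp add: gr_one_powr)

lemma poisson_rate_pos: "a > 1 \<Longrightarrow> n \<ge> 1 \<Longrightarrow> poisson_rate n a > 0"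
  using powr_inverse_gt_one[of a n] by (simp add: poisson_rate_def)

lemma S_star_term_poisson:
  assumes "a > 1"
  shows "S_star_term n a f x k =
    exp (- (poisson_rate n a * x)) * ((poisson_rate n a * x) ^ k / fact k) * f (real k / real n)"
  using assms
  by (simp add: S_star_term_def poisson_rate_def powr_def power_divide power_mult_distrib
        field_simps)

lemma S_star_term_nonneg:
  assumes "a > 1" "n \<ge> 1" "x \<ge> 0" "\<And>t. t \<ge> 0 \<Longrightarrow> f t \<ge> 0"
  shows "S_star_term n a f x k \<ge> 0"
  using assms poisson_rate_pos[of a n] by (auto simp: S_star_term_poisson intro!: mult_nonneg_nonneg)

lemma S_star_term_mono:
  assumes "a > 1" "n \<ge> 1" "x \<ge> 0" "\<And>t. t \<ge> 0 \<Longrightarrow> f t \<le> g t"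
  shows "S_star_term n a f x k \<le> S_star_term n a g x k"
  using S_star_term_nonneg[of a n x "\<lambda>t. g t - f t" k] assms
  by (simp add: S_star_term_def right_diff_distrib)

lemma abs_S_star_term:
  assumes "a > 1" "n \<ge> 1" "x \<ge> 0"
  shows "\<bar>S_star_term n a f x k\<bar> = S_star_term n a (\<lambda>t. \<bar>f t\<bar>) x k"
  using assms poisson_rate_pos[of a n] by (simp add: S_star_term_poisson abs_mult)

lemma S_star_term_add:
  "S_star_term n a (\<lambda>t. f t + g t) x = (\<lambda>k. S_star_term n a f x k + S_star_term n a g x k)"
  by (simp add: fun_eq_iff S_star_term_def distrib_left)

lemma S_star_term_diff:
  "S_star_term n a (\<lambda>t. f t - g t) x = (\<lambda>k. S_star_term n a f x k - S_star_term n a g x k)"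
  by (simp add: fun_eq_iff S_star_term_def right_diff_distrib)

lemma S_star_term_cmult:
  "S_star_term n a (\<lambda>t. c * f t) x = (\<lambda>k. c * S_star_term n a f x k)"
  by (simp add: fun_eq_iff S_star_term_def)

section \<open>Exact values on exponentials\<close>

text \<open>
  Since \<open>a\<^sup>m\<^sup>k\<^sup>/\<^sup>n\<close> is the \<open>k\<close>-th power of \<open>a\<^sup>m\<^sup>/\<^sup>n\<close>, an exponential only changes the argument of the
  exponential series.
\<close>

lemma S_star_term_exponential_sums:
  assumes "a > 1"
  shows "S_star_term n a (\<lambda>t. a powr (m * t)) x sums
           exp (poisson_rate n a * x * (a powr (m / real n) - 1))"
proof -
  define L q where "L = poisson_rate n a * x" and "q = a powr (m / real n)"
  have eq: "S_star_term n a (\<lambda>t. a powr (m * t)) x k = exp (- L) * ((L * q) ^ k /\<^sub>R fact k)" for k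
  proof -
    have "a powr (m * (real k / real n)) = q ^ k"
      using assms by (simp add: q_def powr_power field_simps)
    then show ?thesis
      using assms by (simp add: S_star_term_poisson L_def power_mult_distrib field_simps)
  qed
  have "(\<lambda>k. exp (- L) * ((L * q) ^ k /\<^sub>R fact k)) sums (exp (- L) * exp (L * q))"
    by (intro sums_mult exp_converges)
  moreover have "exp (- L) * exp (L * q) = exp (L * (q - 1))"
    by (simp add: exp_add[symmetric] algebra_simps)
  moreover have "S_star_term n a (\<lambda>t. a powr (m * t)) x = (\<lambda>k. exp (- L) * ((L * q) ^ k /\<^sub>R fact k))"
    using eq by blast
  ultimately show ?thesis
    by (simp only: L_def q_def)
qed

lemma S_star_term_one_sums:
  assumes "a > 1"
  shows "S_star_term n a (\<lambda>t. 1) x sums 1"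
  using S_star_term_exponential_sums[of a n 0 x] assms by simp

lemma S_star_term_powr_sums:
  assumes "a > 1" "n \<ge> 1"
  shows "S_star_term n a (\<lambda>t. a powr t) x sums (a powr x)"
  using S_star_term_exponential_sums[of a n 1 x] powr_inverse_gt_one[of a n] assms
  by (simp add: poisson_rate_def powr_def mult.commute)

lemma S_star_term_powr2_sums:
  assumes "a > 1" "n \<ge> 1"
  shows "S_star_term n a (\<lambda>t. a powr (2 * t)) x sums
           (a powr (2 * x) * a powr (x * (a powr (1 / real n) - 1)))"
proof -
  define h where "h = a powr (1 / real n) - 1"
  have h: "h > 0"
    using powr_inverse_gt_one[of a n] assms by (simp add: h_def)
  have "a powr (2 / real n) = (a powr (1 / real n))\<^sup>2"
    using assms by (simp add: powr_power)
  also have "\<dots> = (1 + h)\<^sup>2"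
    by (simp add: h_def)
  finally have "a powr (2 / real n) - 1 = h * (2 + h)"
    by (simp add: power2_eq_square algebra_simps)
  moreover have "poisson_rate n a = ln a / h"
    by (simp add: poisson_rate_def h_def)
  ultimately have "poisson_rate n a * x * (a powr (2 / real n) - 1) = ln a * x * (2 + h)"
    using h by simp
  then have "exp (poisson_rate n a * x * (a powr (2 / real n) - 1)) = a powr (2 * x) * a powr (x * h)"
    using assms by (simp add: powr_def exp_add[symmetric] algebra_simps)
  then show ?thesis
    using S_star_term_exponential_sums[of a n 2 x] assms by (simp add: h_def)
qed

text \<open>
  The variance-like quantity of the Korovkin argument. In \<open>a\<^sup>2\<^sup>x a\<^sup>x\<^sup>h - 2 a\<^sup>x a\<^sup>x + a\<^sup>2\<^sup>x\<close> everything cancels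
  except the factor by which \<open>S_star\<close> fails to reproduce \<open>a\<^sup>2\<^sup>t\<close>.
\<close>

lemma squared_deviation_sums:
  assumes "a > 1" "n \<ge> 1"
  shows "S_star_term n a (\<lambda>t. (a powr t - a powr x)\<^sup>2) x sums
           (a powr (2 * x) * (a powr (x * (a powr (1 / real n) - 1)) - 1))"
proof -
  have sq: "a powr (2 * t) = (a powr t)\<^sup>2" for t
    using assms by (simp add: powr_power mult.commute)
  have expand: "(\<lambda>t. (a powr t - a powr x)\<^sup>2)
      = (\<lambda>t. a powr (2 * t) - 2 * a powr x * a powr t + a powr (2 * x) * 1)"
    unfolding sq by (simp add: power2_diff fun_eq_iff)
  have "S_star_term n a (\<lambda>t. (a powr t - a powr x)\<^sup>2) x sums
        (a powr (2 * x) * a powr (x * (a powr (1 / real n) - 1)) - 2 * a powr x * a powr x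
           + a powr (2 * x) * 1)"
    unfolding expand S_star_term_add S_star_term_diff S_star_term_cmult using assms
    by (intro sums_add sums_diff sums_mult S_star_term_powr2_sums S_star_term_powr_sums
          S_star_term_one_sums)
  moreover have "a powr (2 * x) * p - 2 * a powr x * a powr x + a powr (2 * x) * 1
      = a powr (2 * x) * (p - 1)" for p
    unfolding sq by (simp add: power2_eq_square algebra_simps)
  ultimately show ?thesis
    by simp
qed

section \<open>Functions of exponential growth\<close>

lemma summable_S_star_term:
  assumes "a > 1" "n \<ge> 1" "x \<ge> 0" and "\<And>t. t \<ge> 0 \<Longrightarrow> \<bar>f t\<bar> \<le> M * a powr (2 * t)"
  shows "summable (S_star_term n a f x)"
proof (rule summable_comparison_test')
  show "summable (\<lambda>k. M * S_star_term n a (\<lambda>t. a powr (2 * t)) x k)"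
    using S_star_term_powr2_sums assms by (intro summable_mult) (blast intro: sums_summable)
  show "norm (S_star_term n a f x k) \<le> M * S_star_term n a (\<lambda>t. a powr (2 * t)) x k" for k
    using S_star_term_mono[of a n x "\<lambda>t. \<bar>f t\<bar>" "\<lambda>t. M * a powr (2 * t)" k] assms
    by (simp add: abs_S_star_term S_star_term_cmult)
qed

lemma powr_ge_one_nonneg:
  fixes a t :: real
  assumes "a > 1" "t \<ge> 0"
  shows "1 \<le> a powr t"
  using assms by (simp add: ge_one_powr_ge_zero)

lemma C_B_exponential_bound:
  assumes "a > 1" "f \<in> C_B"
  obtains M where "\<And>t. t \<ge> 0 \<Longrightarrow> \<bar>f t\<bar> \<le> M" "\<And>t. t \<ge> 0 \<Longrightarrow> \<bar>f t\<bar> \<le> M * a powr (2 * t)"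
proof -
  from assms obtain M where M: "\<And>t. t \<ge> 0 \<Longrightarrow> \<bar>f t\<bar> \<le> M"
    unfolding C_B_def bounded_iff by auto
  moreover have "\<bar>f t\<bar> \<le> M * a powr (2 * t)" if "t \<ge> 0" for t
  proof -
    have "M \<ge> 0" using M[of 0] by linarith
    then have "M * 1 \<le> M * a powr (2 * t)"
      using assms that by (intro mult_left_mono powr_ge_one_nonneg) auto
    with M[OF that] show ?thesis by linarith
  qed
  ultimately show thesis
    using that by blast
qed

text \<open>
  Exponentials dominate powers, so \<open>\<bar>f t\<bar>\<close> is eventually below \<open>a\<^sup>2\<^sup>t\<close>; on the remaining compact interval
  continuity supplies the constant.
\<close>

lemma C_rho_exponential_bound:
  assumes "a > 1" "f \<in> C_rho \<rho>"
  obtains M where "\<And>t. t \<ge> 0 \<Longrightarrow> \<bar>f t\<bar> \<le> M * a powr (2 * t)"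
proof -
  from assms obtain L where cont: "continuous_on {0..} f"
    and L: "((\<lambda>x. f x / (1 + x powr \<rho>)) \<longlongrightarrow> L) at_top"
    unfolding C_rho_def by auto
  have pos: "1 + x powr \<rho> > 0" for x :: real
    by (simp add: add_pos_nonneg)
  have "((\<lambda>x. (1 + x powr \<rho>) / a powr (2 * x)) \<longlongrightarrow> 0) at_top"
    using assms(1) by real_asymp
  from tendsto_mult[OF L this] have "((\<lambda>x. f x / a powr (2 * x)) \<longlongrightarrow> 0) at_top"
    using pos by (simp add: less_imp_neq[symmetric])
  then have "\<forall>\<^sub>F x in at_top. \<bar>f x / a powr (2 * x)\<bar> < 1"
    by (auto dest: tendstoD[where e = 1])
  then obtain T where T: "\<And>x. x \<ge> T \<Longrightarrow> \<bar>f x / a powr (2 * x)\<bar> < 1"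
    unfolding eventually_at_top_linorder by blast
  have "bounded (f ` {0..T})"
    by (intro compact_imp_bounded compact_continuous_image continuous_on_subset[OF cont]) auto
  then obtain B where B: "\<And>x. 0 \<le> x \<Longrightarrow> x \<le> T \<Longrightarrow> \<bar>f x\<bar> \<le> B"
    unfolding bounded_iff by (metis atLeastAtMost_iff image_eqI real_norm_def)
  have "\<bar>f t\<bar> \<le> max 1 B * a powr (2 * t)" if "t \<ge> 0" for t
  proof (cases "t \<ge> T")
    case True
    have "\<bar>f t\<bar> \<le> 1 * a powr (2 * t)"
      using T[OF True] assms(1) by (simp add: abs_divide divide_simps)
    also have "\<dots> \<le> max 1 B * a powr (2 * t)"
      by (intro mult_right_mono) auto
    finally show ?thesis .
  next
    case False
    have "\<bar>f t\<bar> \<le> max 1 B * 1"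
      using B[of t] that False by simp
    also have "\<dots> \<le> max 1 B * a powr (2 * t)"
      using assms that by (intro mult_left_mono powr_ge_one_nonneg) auto
    finally show ?thesis .
  qed
  with that show thesis by blast
qed

section \<open>The operator on bounded functions\<close>

text \<open>
  Apart from the factor \<open>exp (- \<lambda> x)\<close> the series is a power series in \<open>x\<close>, so convergence at every
  \<open>x \<ge> 0\<close> already yields continuity.
\<close>

lemma continuous_on_S_star:
  assumes "a > 1" "S_star_defined n a f"
  shows "continuous_on {0..} (S_star n a f)"
proof -
  define L where "L = poisson_rate n a"
  define c where "c k = L ^ k / fact k * f (real k / real n)" for k
  have eq: "S_star_term n a f x k = exp (- (L * x)) * (c k * x ^ k)" for x k
    using assms(1) by (simp add: S_star_term_poisson L_def c_def power_mult_distrib)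
  have summ: "summable (\<lambda>k. c k * x ^ k)" if "x \<ge> 0" for x
  proof -
    have "summable (\<lambda>k. exp (L * x) * (exp (- (L * x)) * (c k * x ^ k)))"
      using assms(2) that unfolding S_star_defined_def by (intro summable_mult) (simp add: eq[abs_def])
    then show ?thesis
      by (simp add: mult.assoc[symmetric] exp_add[symmetric])
  qed
  have S: "S_star n a f x = exp (- (L * x)) * (\<Sum>k. c k * x ^ k)" if "x \<ge> 0" for x
    by (simp add: S_star_def eq suminf_mult summ that)
  have "isCont (\<lambda>x. \<Sum>k. c k * x ^ k) x" if "x \<ge> 0" for x
    using that by (intro isCont_powser[where K = "x + 1"] summ) auto
  then have "continuous_on {0..} (\<lambda>x. exp (- (L * x)) * (\<Sum>k. c k * x ^ k))"
    by (intro continuous_intros) (auto intro!: continuous_at_imp_continuous_on)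
  then show ?thesis
    using S by (subst continuous_on_cong[OF refl, where g = "\<lambda>x. exp (- (L * x)) * (\<Sum>k. c k * x ^ k)"]) auto
qed

text \<open>
  Domination is transported from \<open>f\<close> to its image: this single estimate gives both the
  boundedness of the image of a bounded function (\<open>g\<close> constant) and the Korovkin bound.
\<close>

lemma abs_S_star_le:
  assumes "a > 1" "n \<ge> 1" "x \<ge> 0" "\<And>t. t \<ge> 0 \<Longrightarrow> \<bar>f t\<bar> \<le> g t" "S_star_term n a g x sums G"
  shows "\<bar>S_star n a f x\<bar> \<le> G"
proof -
  have le: "norm (S_star_term n a f x k) \<le> S_star_term n a g x k" for k
    using S_star_term_mono[of a n x "\<lambda>t. \<bar>f t\<bar>" g k] assms by (simp add: abs_S_star_term)
  have "norm (\<Sum>k. S_star_term n a f x k) \<le> (\<Sum>k. S_star_term n a g x k)"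
    using le assms(5) by (intro norm_suminf_le sums_summable)
  then show ?thesis
    using assms(5) by (simp add: S_star_def sums_iff)
qed

lemma S_star_defined_C_B:
  assumes "a > 1" "n \<ge> 1" "f \<in> C_B"
  shows "S_star_defined n a f"
  by (metis C_B_exponential_bound S_star_defined_def assms summable_S_star_term)

lemma S_star_in_C_B:
  assumes "a > 1" "n \<ge> 1" "f \<in> C_B"
  shows "S_star n a f \<in> C_B"
proof -
  obtain M where M: "\<And>t. t \<ge> 0 \<Longrightarrow> \<bar>f t\<bar> \<le> M"
    using C_B_exponential_bound assms by blast
  have "\<bar>S_star n a f x\<bar> \<le> M" if "x \<ge> 0" for x
  proof (rule abs_S_star_le[where g = "\<lambda>t. M"])
    show "S_star_term n a (\<lambda>t. M) x sums M"
      using sums_mult[OF S_star_term_one_sums, of a M n x] assms(1)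
      S_star_term_cmult[of n a M "\<lambda>t. 1" x] by simp
  qed (use assms that M in auto)
  then have "bounded (S_star n a f ` {0..})"
    unfolding bounded_iff by auto
  then show ?thesis
    using continuous_on_S_star S_star_defined_C_B assms by (simp add: C_B_def)
qed

lemma linear_operator_on_S_star:
  assumes "a > 1" "n \<ge> 1"
  shows "linear_operator_on C_B (S_star n a)"
proof -
  have summ: "summable (S_star_term n a f x)" if "f \<in> C_B" "x \<ge> 0" for f x
    using S_star_defined_C_B assms that by (simp add: S_star_defined_def)
  show ?thesis
    unfolding linear_operator_on_def
    using S_star_in_C_B[OF assms] summ
    by (auto simp: S_star_def S_star_term_add S_star_term_cmult suminf_add suminf_mult)
qed

lemma positive_operator_on_S_star:
  assumes "a > 1" "n \<ge> 1"
  shows "positive_operator_on C_B (S_star n a)"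
  unfolding positive_operator_on_def S_star_def
  using S_star_defined_C_B[OF assms] S_star_term_nonneg[OF assms]
  by (auto simp: S_star_defined_def intro!: suminf_nonneg)

section \<open>Uniform convergence\<close>

text \<open>
  Going up by at least \<open>\<delta>\<close> multiplies \<open>a\<^sup>t\<close> by at least \<open>a\<^sup>\<delta>\<close>, so the difference is at least a fixed
  proportion of the larger of the two values.
\<close>

lemma powr_diff_ge_proportion:
  fixes a :: real
  assumes "a > 1" "s + \<delta> \<le> t"
  shows "(1 - a powr (- \<delta>)) * a powr t \<le> a powr t - a powr s"
proof -
  have "a powr s \<le> a powr (t - \<delta>)"
    using assms by (intro powr_mono) auto
  also have "\<dots> = a powr (- \<delta>) * a powr t"
    by (simp add: powr_add[symmetric])
  finally show ?thesis
    by (simp add: algebra_simps)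
qed

text \<open>
  Close to \<open>x\<close>, uniform continuity bounds the increment of \<open>f\<close> by \<open>\<epsilon>\<close>. Far from \<open>x\<close>, the
  squared deviation is at least \<open>q\<^sup>2 max (a\<^sup>2\<^sup>t) (a\<^sup>2\<^sup>x)\<close>, which absorbs \<open>\<bar>f t\<bar> + \<bar>f x\<bar>\<close> precisely because
  \<open>f\<close> is \<open>O(a\<^sup>2\<^sup>t)\<close>.
\<close>

lemma modulus_by_squared_deviation:
  fixes f :: "real \<Rightarrow> real"
  assumes a: "a > 1" and cont: "continuous_on {0..} f"
    and M: "\<And>t. t \<ge> 0 \<Longrightarrow> \<bar>f t\<bar> \<le> M * a powr (2 * t)" and "\<epsilon> > 0"
  obtains C where "C \<ge> 0"
    "\<And>x t. 0 \<le> x \<Longrightarrow> x \<le> b \<Longrightarrow> t \<ge> 0 \<Longrightarrow> \<bar>f t - f x\<bar> \<le> \<epsilon> + C * (a powr t - a powr x)\<^sup>2"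
proof -
  have "uniformly_continuous_on {0..b + 1} f"
    by (intro compact_uniformly_continuous continuous_on_subset[OF cont]) auto
  then obtain d where d: "d > 0"
    "\<And>x t. x \<in> {0..b + 1} \<Longrightarrow> t \<in> {0..b + 1} \<Longrightarrow> dist t x < d \<Longrightarrow> dist (f t) (f x) < \<epsilon>"
    using \<open>\<epsilon> > 0\<close> unfolding uniformly_continuous_on_def by blast
  \<comment> \<open>Capping at \<open>1\<close> keeps points within \<open>\<delta>\<close> of \<open>[0, b]\<close> inside the interval of uniform continuity.\<close>
  define \<delta> where "\<delta> = min d 1"
  define q where "q = 1 - a powr (- \<delta>)"
  have "\<delta> > 0"
    using d by (simp add: \<delta>_def)
  then have "q > 0"
    using a by (simp add: q_def powr_less_one)
  have "M \<ge> 0"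
    using M[of 0] a by simp
  have sq: "a powr (2 * t) = (a powr t)\<^sup>2" for t
    using a by (simp add: powr_power mult.commute)
  \<comment> \<open>The far case, for an increasing pair; both orders of \<open>t\<close> and \<open>x\<close> reduce to it.\<close>
  have far: "\<bar>f u - f s\<bar> \<le> 2 * M / q\<^sup>2 * (a powr u - a powr s)\<^sup>2"
    if "s \<ge> 0" "s + \<delta> \<le> u" for s u
  proof -
    have "a powr s \<le> a powr u"
      using a that \<open>\<delta> > 0\<close> by (intro powr_mono) auto
    then have su: "a powr (2 * s) \<le> (a powr u)\<^sup>2"
      by (simp add: sq power_mono)
    have "\<bar>f u - f s\<bar> \<le> M * a powr (2 * u) + M * a powr (2 * s)"
      using M[of u] M[of s] that \<open>\<delta> > 0\<close> by linarith
    also have "\<dots> \<le> 2 * M * (a powr u)\<^sup>2"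
      using mult_left_mono[OF su \<open>M \<ge> 0\<close>] by (simp add: sq)
    also have "\<dots> = 2 * M / q\<^sup>2 * (q * a powr u)\<^sup>2"
      using \<open>q > 0\<close> by (simp add: power_mult_distrib)
    also have "\<dots> \<le> 2 * M / q\<^sup>2 * (a powr u - a powr s)\<^sup>2"
      using powr_diff_ge_proportion[OF a that(2)] \<open>q > 0\<close> \<open>M \<ge> 0\<close>
      by (intro mult_left_mono power_mono) (auto simp: q_def)
    finally show ?thesis .
  qed
  show thesis
  proof
    show C: "2 * M / q\<^sup>2 \<ge> 0"
      using \<open>M \<ge> 0\<close> by simp
    fix x t :: real
    assume x: "0 \<le> x" "x \<le> b" and t: "t \<ge> 0"
    show "\<bar>f t - f x\<bar> \<le> \<epsilon> + 2 * M / q\<^sup>2 * (a powr t - a powr x)\<^sup>2"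
    proof (cases "\<bar>t - x\<bar> < \<delta>")
      case True
      then have "dist (f t) (f x) < \<epsilon>"
        using x t by (intro d) (auto simp: \<delta>_def dist_real_def)
      moreover have "2 * M / q\<^sup>2 * (a powr t - a powr x)\<^sup>2 \<ge> 0"
        using C by (intro mult_nonneg_nonneg) auto
      ultimately show ?thesis
        by (simp add: dist_real_def)
    next
      case False
      then consider "x + \<delta> \<le> t" | "t + \<delta> \<le> x"
        by linarith
      then show ?thesis
        using far[of x t] far[of t x] x t \<open>\<epsilon> > 0\<close>
        by cases (auto simp: abs_minus_commute power2_commute)
    qed
  qed
qed

lemma S_star_uniform_limit:
  fixes f :: "real \<Rightarrow> real"
  assumes a: "a > 1" and cont: "continuous_on {0..} f"
    and M: "\<And>t. t \<ge> 0 \<Longrightarrow> \<bar>f t\<bar> \<le> M * a powr (2 * t)"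
  shows "uniform_limit {0..b} (\<lambda>n. S_star n a f) f sequentially"
proof (rule uniform_limitI)
  fix e :: real
  assume "e > 0"
  then obtain C where C: "C \<ge> 0"
    "\<And>x t. 0 \<le> x \<Longrightarrow> x \<le> b \<Longrightarrow> t \<ge> 0 \<Longrightarrow> \<bar>f t - f x\<bar> \<le> e / 2 + C * (a powr t - a powr x)\<^sup>2"
    using modulus_by_squared_deviation[OF a cont M, of "e / 2" b] by auto
  define D where "D n = C * (a powr (2 * b) * (a powr (b * (a powr (1 / real n) - 1)) - 1))" for n
  have "(\<lambda>n. a powr (1 / real n)) \<longlonglongrightarrow> a powr 0"
    using a by (intro tendsto_intros lim_1_over_n) auto
  then have "D \<longlonglongrightarrow> C * (a powr (2 * b) * (a powr (b * (a powr 0 - 1)) - 1))"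
    unfolding D_def using a by (intro tendsto_intros) auto
  then have "D \<longlonglongrightarrow> 0"
    using a by simp
  then have "\<forall>\<^sub>F n in sequentially. D n < e / 2"
    using \<open>e > 0\<close> by (intro order_tendstoD) auto
  then show "\<forall>\<^sub>F n in sequentially. \<forall>x\<in>{0..b}. dist (S_star n a f x) (f x) < e"
    using eventually_ge_at_top[of 1]
  proof eventually_elim
    case (elim n)
    show ?case
    proof
      fix x
      assume x: "x \<in> {0..b}"
      define h where "h = a powr (1 / real n) - 1"
      have "h > 0"
        using powr_inverse_gt_one[OF a elim(2)] by (simp add: h_def)
      have one: "S_star_term n a (\<lambda>t. c) x sums c" for c
        using sums_mult[OF S_star_term_one_sums[OF a], of c n x]
          S_star_term_cmult[of n a c "\<lambda>t. 1" x] by simp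
      have "summable (S_star_term n a f x)"
        using summable_S_star_term[OF a elim(2) _ M] x by simp
      \<comment> \<open>As constants are reproduced, the error at \<open>x\<close> is the image of \<open>f - f x\<close>.\<close>
      then have "S_star n a (\<lambda>t. f t - f x) x = S_star n a f x - f x"
        using one[of "f x"] by (simp add: S_star_def S_star_term_diff suminf_diff[symmetric] sums_iff)
      moreover have "\<bar>S_star n a (\<lambda>t. f t - f x) x\<bar>
          \<le> e / 2 + C * (a powr (2 * x) * (a powr (x * h) - 1))"
      proof (rule abs_S_star_le[where g = "\<lambda>t. e / 2 + C * (a powr t - a powr x)\<^sup>2"])
        show "S_star_term n a (\<lambda>t. e / 2 + C * (a powr t - a powr x)\<^sup>2) x sums
            (e / 2 + C * (a powr (2 * x) * (a powr (x * h) - 1)))"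
          unfolding S_star_term_add S_star_term_cmult h_def
          by (intro sums_add sums_mult one squared_deviation_sums a elim)
      qed (use a elim x C in auto)
      moreover have "C * (a powr (2 * x) * (a powr (x * h) - 1)) \<le> D n"
        unfolding D_def h_def[symmetric] using C(1) x a \<open>h > 0\<close>
        by (intro mult_left_mono mult_mono diff_right_mono powr_mono mult_right_mono)
          (auto intro!: ge_one_powr_ge_zero)
      ultimately show "dist (S_star n a f x) (f x) < e"
        using elim(1) by (simp add: dist_real_def)
    qed
  qed
qed

theorem theorem4p1:
  fixes a :: real
  assumes "a > 1"
  shows "(\<forall>n\<ge>1. (\<forall>f\<in>C_B. S_star_defined n a f)
             \<and> linear_operator_on C_B (S_star n a)
             \<and> positive_operator_on C_B (S_star n a))
    \<and> (\<forall>n\<ge>1. S_star_defined n a (\<lambda>t. a powr t)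
             \<and> (\<forall>x\<ge>0. S_star n a (\<lambda>t. a powr t) x = a powr x))
    \<and> (\<forall>\<rho>\<ge>2. \<forall>f\<in>C_rho \<rho>. (\<forall>n\<ge>1. S_star_defined n a f)
             \<and> (\<forall>b>0. uniform_limit {0..b} (\<lambda>n. S_star n a f) f sequentially))"
proof (intro conjI allI ballI impI)
  fix n :: nat
  assume n: "n \<ge> 1"
  show "S_star_defined n a f" if "f \<in> C_B" for f
    using S_star_defined_C_B assms n that by blast
  show "linear_operator_on C_B (S_star n a)"
    using linear_operator_on_S_star assms n by blast
  show "positive_operator_on C_B (S_star n a)"
    using positive_operator_on_S_star assms n by blast
  show "S_star_defined n a (\<lambda>t. a powr t)"
    using S_star_term_powr_sums[OF assms n] by (auto simp: S_star_defined_def sums_iff)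
  show "S_star n a (\<lambda>t. a powr t) x = a powr x" for x
    using S_star_term_powr_sums[OF assms n] by (simp add: S_star_def sums_iff)
next
  fix \<rho> f
  assume f: "f \<in> C_rho \<rho>"
  obtain M where M: "\<And>t. t \<ge> 0 \<Longrightarrow> \<bar>f t\<bar> \<le> M * a powr (2 * t)"
    using C_rho_exponential_bound assms f by blast
  show "S_star_defined n a f" if "n \<ge> 1" for n
    using summable_S_star_term[OF assms that _ M] by (simp add: S_star_defined_def)
  show "uniform_limit {0..b} (\<lambda>n. S_star n a f) f sequentially" for b
    using S_star_uniform_limit[OF assms _ M] f by (simp add: C_rho_def)
qed

end
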